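(* Let $0<\lambda\le 1$ and let $f\in\mathcal{N}(\lambda)$. Then for $|z|=r<1$ the following inequalities hold: (i) $-\mathbf{N}_{F_\lambda}(-r)=r(1-r)^{\lambda}\le |f(z)|\le r(1+r)^{\lambda}=\mathbf{N}_{F_\lambda}(r)$; (ii) $\left|\arg\left\{\frac{f(z)}{z}\right\}\right|\le \lambda\sin^{-1}r$. Equalities hold for the function $f(z)=\mathbf{N}_{F_\lambda}(z)$ or its rotations.
   Context: $\mathbb{D}=\{z\in\mathbb{C}:|z|<1\}$. $\mathcal{A}$ is the class of holomorphic functions in $\mathbb{D}$ of the form $f(z)=z+\sum_{n\ge 2}a_nz^n$. For $0<\lambda\le1$, $\mathcal{N}(\lambda)$ is the class of $f\in\mathcal{A}$ such that $\Re\left(zf'(z)/f(z)\right)<1+\lambda/2$ for all $z\in\mathbb{D}$. $\mathbf{N}_{F_\lambda}(z)=z(1+z)^\lambda$, with the branch $(1+z)^\lambda=e^{\lambda\log(1+z)}$ equal to $1$ at $z=0$. A rotation of a function $f$ is a function $\overline{\mu}f(\mu z)$ with $|\mu|=1$. The quantity $f(z)/z$ is understood to equal $1$ at $z=0$, and $\arg\{f(z)/z\}$ is the continuous branch with value $0$ at $z=0$. That equalities hold for a function means that, for each $r$, each bound is attained by it at some point of $|z|=r$. *)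

theory Defs
  imports "HOL-Complex_Analysis.Complex_Analysis"
begin

abbreviation unit_disc :: "complex set" ("\<D>")
  where "\<D> \<equiv> ball 0 1"

definition class_A :: "(complex \<Rightarrow> complex) set" where
  "class_A = {f. f holomorphic_on \<D> \<and>
     (\<exists>a :: nat \<Rightarrow> complex. a 0 = 0 \<and> a 1 = 1 \<and> (\<forall>z\<in>\<D>. (\<lambda>n. a n * z ^ n) sums f z))}"

text \<open>
  At \<open>z = 0\<close> the quotient \<open>z f'(z) / f(z)\<close> is read as its limit 1, and the inequality holds
  there; with \<open>x / 0 = 0\<close> it holds as well, so \<open>0\<close> needs no special treatment.
  No separate condition excludes other zeros of \<open>f\<close>: each of them would be a pole of
  \<open>z f'(z) / f(z)\<close>, and the real part would be unbounded above in any punctured neighbourhood.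
\<close>

definition class_N :: "real \<Rightarrow> (complex \<Rightarrow> complex) set" where
  "class_N lam = {f \<in> class_A. \<forall>z\<in>\<D>. Re (z * deriv f z / f z) < 1 + lam / 2}"

text \<open>On the unit disc \<open>Re (1 + z) > 0\<close>, so the principal branch in \<open>powr\<close> is the
  branch of \<open>(1 + z)\<^sup>\<lambda>\<close> with value 1 at 0.\<close>

definition N_F :: "real \<Rightarrow> complex \<Rightarrow> complex" where
  "N_F lam z = z * (1 + z) powr complex_of_real lam"

definition rotation :: "complex \<Rightarrow> (complex \<Rightarrow> complex) \<Rightarrow> complex \<Rightarrow> complex" where
  "rotation \<mu> f = (\<lambda>z. cnj \<mu> * f (\<mu> * z))"

definition quot_id :: "(complex \<Rightarrow> complex) \<Rightarrow> complex \<Rightarrow> complex" where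
  "quot_id f z = (if z = 0 then 1 else f z / z)"

text \<open>
  \<open>arg_branch q \<theta>\<close>: \<open>\<theta>\<close> is the continuous branch of \<open>arg q\<close> on the unit disc with
  \<open>\<theta> 0 = 0\<close>. Nonvanishing has to be required because \<open>is_Arg 0 t\<close> holds for every \<open>t\<close>.
  The values of \<open>\<theta>\<close> on the disc are determined by \<open>q\<close>; those outside are irrelevant.
\<close>

definition arg_branch :: "(complex \<Rightarrow> complex) \<Rightarrow> (complex \<Rightarrow> real) \<Rightarrow> bool" where
  "arg_branch q \<theta> \<longleftrightarrow> continuous_on \<D> \<theta> \<and> \<theta> 0 = 0 \<and> (\<forall>z\<in>\<D>. q z \<noteq> 0 \<and> is_Arg (q z) (\<theta> z))"

end

theory Submission
  imports Defs
begin

text \<open>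
  The heart of the matter is that \<open>f(z)/z = (1 + w(z))\<^sup>\<lambda>\<close> for a Schwarz function \<open>w\<close>, that is, a
  holomorphic self-map \<open>w\<close> of the unit disc with \<open>w(0) = 0\<close> (\<open>class_N_representation\<close>). By
  the Schwarz lemma \<open>|w(z)| \<le> |z|\<close>, so the value \<open>1 + w(z)\<close> lies in the disc of radius \<open>r = |z|\<close>
  about \<open>1\<close>. There the modulus ranges over \<open>[1 - r, 1 + r]\<close>, and the tangents from \<open>0\<close> to this disc
  make the angle \<open>arcsin r\<close> with the real axis. Taking \<open>\<lambda>\<close>-th powers gives both (i) and (ii). For the
  rotations of \<open>N_F\<close> the function \<open>w\<close> is itself a rotation \<open>w(z) = \<mu>z\<close>, so \<open>1 + w\<close> sweeps the whole
  circle \<open>|u - 1| = r\<close> and meets its two real points and its points of tangency.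

  The representation rests on two arguments. To begin with, \<open>f\<close> has no zero besides \<open>0\<close>
  (\<open>class_N_nonzero\<close>): the bound on \<open>Re (z f'/f)\<close> is a bound on the logarithmic growth of \<open>|f|\<close>
  along rays, so a zero would force \<open>f\<close> to vanish on the rest of its ray, hence identically.
  Therefore \<open>f(z)/z = exp (H(z))\<close> with \<open>H\<close> holomorphic and \<open>H(0) = 0\<close>, and
  \<open>w = exp (H/\<lambda>) - 1\<close> satisfies \<open>z f'/f = 1 + \<lambda> z w'/(1 + w)\<close>. If \<open>|w|\<close> ever reached \<open>1\<close>, Jack's
  lemma at a first such point \<open>p\<close> would give \<open>p w'(p) = k w(p)\<close> with \<open>k \<ge> 1\<close>; as
  \<open>Re (w/(1 + w)) = 1/2\<close> on the unit circle, \<open>Re (z f'/f)\<close> would be at least \<open>1 + \<lambda>/2\<close> at \<open>p\<close>.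
\<close>

section \<open>Normalised power series\<close>

lemma class_A_D:
  assumes "f \<in> class_A"
  shows "f holomorphic_on \<D>" "f 0 = 0" "deriv f 0 = 1"
proof -
  from assms obtain a :: "nat \<Rightarrow> complex" where hol: "f holomorphic_on \<D>"
    and a: "a 0 = 0" "a 1 = 1" and s: "\<And>z. z \<in> \<D> \<Longrightarrow> (\<lambda>n. a n * z ^ n) sums f z"
    unfolding class_A_def by blast
  show "f holomorphic_on \<D>" by (fact hol)
  show "f 0 = 0" using s[of 0] a by simp
  have d: "(f has_field_derivative deriv f 0) (at 0)"
    by (rule holomorphic_derivI[OF hol]) auto
  have "(\<lambda>n. diffs a n * 0 ^ n) sums deriv f 0"
    by (rule termdiffs_sums_strong[where K = 1 and f = f, OF _ d]) (auto intro: s)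
  then show "deriv f 0 = 1" using a by (simp add: diffs_def)
qed

lemma class_A_I:
  assumes "f holomorphic_on \<D>" "f 0 = 0" "deriv f 0 = 1"
  shows "f \<in> class_A"
  unfolding class_A_def
proof (intro CollectI conjI exI[of _ "\<lambda>n. (deriv ^^ n) f 0 / fact n"] ballI)
  fix z :: complex assume "z \<in> \<D>"
  then show "(\<lambda>n. (deriv ^^ n) f 0 / fact n * z ^ n) sums f z"
    using holomorphic_power_series[OF assms(1), of z] by simp
qed (use assms in auto)

lemma quot_id_holomorphic:
  assumes "f \<in> class_A"
  shows "quot_id f holomorphic_on \<D>"
proof -
  have "quot_id f = (\<lambda>z. if z = 0 then deriv f 0 else (f z - f 0) / (z - 0))"
    using class_A_D[OF assms] by (auto simp: quot_id_def)
  then show ?thesis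
    using pole_lemma[OF class_A_D(1)[OF assms], of 0] by simp
qed

section \<open>Derivatives of the squared modulus\<close>

lemma DERIV_cmod_square:
  assumes "(\<gamma> has_vector_derivative v) (at t)"
  shows "((\<lambda>t. (cmod (\<gamma> t))\<^sup>2) has_real_derivative 2 * Re (cnj (\<gamma> t) * v)) (at t)"
proof -
  have "((\<lambda>t. Re (\<gamma> t)) has_real_derivative Re v) (at t)"
       "((\<lambda>t. Im (\<gamma> t)) has_real_derivative Im v) (at t)"
    using assms by (auto simp: has_vector_derivative_complex_iff)
  from DERIV_add[OF DERIV_power[OF this(1), of 2] DERIV_power[OF this(2), of 2]]
  show ?thesis by (simp add: cmod_power2 algebra_simps)
qed

lemma DERIV_cmod_square_ray:
  assumes "g holomorphic_on \<D>" "of_real t * p \<in> \<D>"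
  shows "((\<lambda>t. (cmod (g (of_real t * p)))\<^sup>2) has_real_derivative
    2 * Re (cnj (g (of_real t * p)) * (p * deriv g (of_real t * p)))) (at t)"
proof (rule DERIV_cmod_square)
  have g: "(g has_field_derivative deriv g (of_real t * p)) (at (of_real t * p))"
    using assms by (intro holomorphic_derivI) auto
  have "((\<lambda>t. of_real t * p) has_vector_derivative p) (at t)"
    by (auto intro!: derivative_eq_intros simp: has_vector_derivative_def scaleR_conv_of_real)
  from field_vector_diff_chain_at[OF this g]
  show "((\<lambda>t. g (of_real t * p)) has_vector_derivative p * deriv g (of_real t * p)) (at t)"
    by (simp add: o_def)
qed

section \<open>Functions of the class have a single zero\<close>

text \<open>
  For \<open>c = 1 + \<lambda>/2\<close> and \<open>t \<ge> 1\<close> the function \<open>exp (- 2ct) |f(tp)|\<^sup>2\<close> is nonincreasing, since its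
  derivative is \<open>2 exp (- 2ct) |f(tp)|\<^sup>2 (Re (z f'/f)/t - c)\<close> with \<open>z = tp\<close>, and \<open>0\<close> at a zero. Working with \<open>|f|\<^sup>2\<close> instead
  of \<open>log |f|\<close> lets the argument run through zeros of \<open>f\<close>.
\<close>

lemma class_N_zero_propagates:
  assumes "0 < lam" "f \<in> class_N lam" "1 \<le> T" "of_real T * p \<in> \<D>" "f p = 0"
  shows "f (of_real T * p) = 0"
proof -
  define c where "c = 1 + lam / 2"
  have hol: "f holomorphic_on \<D>"
    using assms(2) class_A_D by (auto simp: class_N_def)
  define F where "F = (\<lambda>t::real. (cmod (f (of_real t * p)))\<^sup>2)"
  have "F 1 * exp (- 2 * c * 1) \<ge> F T * exp (- 2 * c * T)"
  proof (rule DERIV_nonpos_imp_nonincreasing[OF \<open>1 \<le> T\<close>])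
    fix t :: real assume t: "1 \<le> t" "t \<le> T"
    define z where "z = of_real t * p"
    have "cmod z \<le> cmod (of_real T * p)"
      using t by (simp add: z_def norm_mult mult_right_mono)
    then have z: "z \<in> \<D>" using assms(4) by simp
    define D where "D = 2 * Re (cnj (f z) * (p * deriv f z))"
    have "(F has_real_derivative D) (at t)"
      unfolding F_def D_def z_def
      by (rule DERIV_cmod_square_ray[OF hol]) (use z in \<open>simp add: z_def\<close>)
    then have der: "((\<lambda>t. F t * exp (- 2 * c * t)) has_real_derivative
        (D - 2 * c * F t) * exp (- 2 * c * t)) (at t)"
      by (auto intro!: derivative_eq_intros simp: algebra_simps)
    have bound: "D \<le> 2 * c * F t"
    proof (cases "f z = 0")
      case True
      then show ?thesis by (simp add: D_def F_def z_def)
    next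
      case False
      have "t * D = 2 * Re (cnj (f z) * (z * deriv f z))"
        by (simp add: D_def z_def algebra_simps)
      also have "cnj (f z) * (z * deriv f z) = of_real (F t) * (z * deriv f z / f z)"
        using False complex_norm_square[of "f z"]
        unfolding F_def z_def[symmetric] by (simp add: field_simps)
      also have "2 * Re \<dots> = 2 * (F t * Re (z * deriv f z / f z))"
        by (simp del: times_divide_eq_right)
      also have "\<dots> \<le> 2 * (F t * c)"
        using assms(2) z unfolding class_N_def c_def F_def
        by (intro mult_left_mono) (auto intro: less_imp_le)
      also have "\<dots> \<le> t * (2 * c * F t)"
        using t mult_right_mono[of 1 t "2 * c * F t"] assms(1) by (simp add: c_def F_def algebra_simps)
      finally show ?thesis using t by simp
    qed
    show "\<exists>y. ((\<lambda>t. F t * exp (- 2 * c * t)) has_real_derivative y) (at t) \<and> y \<le> 0"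
      by (rule exI, rule conjI, rule der) (use bound in \<open>auto simp: mult_le_0_iff\<close>)
  qed
  moreover have "F 1 = 0" using assms(5) by (simp add: F_def)
  ultimately have "F T * exp (- 2 * c * T) \<le> 0" by simp
  then have "F T \<le> 0" by (simp add: mult_le_0_iff)
  then show ?thesis by (simp add: F_def)
qed

lemma class_N_nonzero:
  assumes "0 < lam" "f \<in> class_N lam" "p \<in> \<D>" "p \<noteq> 0"
  shows "f p \<noteq> 0"
proof
  assume fp: "f p = 0"
  have A: "f \<in> class_A" using assms(2) by (simp add: class_N_def)
  define U where "U = {z \<in> \<D>. \<exists>t\<ge>1. z = of_real t * p}"
  have lim: "p islimpt U"
    unfolding islimpt_approachable
  proof (intro allI impI)
    fix e :: real assume "0 < e"
    define s where "s = min (e / 2) ((1 - cmod p) / 2)"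
    have s: "0 < s" "s < e" "s < 1 - cmod p"
      using \<open>0 < e\<close> assms(3) by (auto simp: s_def min_less_iff_disj)
    define t where "t = 1 + s / cmod p"
    have t: "1 \<le> t" using s by (simp add: t_def)
    have "(t - 1) * cmod p = s" using assms(4) by (simp add: t_def)
    moreover have "of_real t * p - p = of_real (t - 1) * p" by (simp add: algebra_simps)
    ultimately have d: "cmod (of_real t * p - p) = s"
      using t norm_of_real[of "t - 1", where 'a = complex] by (simp add: norm_mult del: norm_of_real)
    have "cmod (of_real t * p) \<le> cmod p + s"
      using norm_triangle_ineq[of p "of_real t * p - p"] d by simp
    then have "of_real t * p \<in> U" using s t by (auto simp: U_def)
    moreover have "of_real t * p \<noteq> p" using d s by auto
    ultimately show "\<exists>x'\<in>U. x' \<noteq> p \<and> dist x' p < e"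
      using d s by (intro bexI[of _ "of_real t * p"]) (auto simp: dist_norm)
  qed
  have zero: "f w = 0" if "w \<in> \<D>" for w
  proof (rule analytic_continuation[OF class_A_D(1)[OF A] _ _ _ assms(3) lim _ that])
    show "f z = 0" if "z \<in> U" for z
      using that class_N_zero_propagates[OF assms(1,2) _ _ fp] by (auto simp: U_def)
  qed (auto simp: U_def)
  have "deriv f 0 = deriv (\<lambda>_. 0) 0"
    by (rule deriv_cong_ev) (auto intro!: eventually_mono[OF eventually_nhds_in_open[of \<D>]] zero)
  then show False using class_A_D(3)[OF A] by simp
qed

section \<open>Jack's lemma\<close>

text \<open>
  The Schwarz lemma, scaled to the disc of radius \<open>|p|\<close>, gives \<open>|w(tp)| \<le> t\<close> for \<open>t \<le> 1\<close>. Equality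
  at \<open>t = 1\<close> makes the radial derivative of \<open>|w|\<^sup>2\<close> at \<open>p\<close> at least \<open>2\<close>, whereas the tangential
  derivative vanishes because \<open>p\<close> maximises \<open>|w|\<close> on its circle. These two derivatives are, up to
  the factors \<open>2\<close> and \<open>- 2\<close>, the real and imaginary part of \<open>p w'(p) / w(p)\<close>.
\<close>

lemma Jack:
  assumes hol: "w holomorphic_on \<D>" and w0: "w 0 = 0" and p: "p \<in> \<D>" "p \<noteq> 0"
    and less: "\<And>z. cmod z < cmod p \<Longrightarrow> cmod (w z) < 1" and one: "cmod (w p) = 1"
  shows "\<exists>k::real. 1 \<le> k \<and> p * deriv w p = of_real k * w p"
proof -
  have ray: "cmod (w (of_real t * p)) \<le> t" if t: "0 \<le> t" "t < 1" for t
  proof -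
    have in_D: "p * z \<in> \<D>" if "cmod z < 1" for z
      using p that mult_strict_mono'[of "cmod p" 1 "cmod z" 1] by (simp add: norm_mult)
    have "cmod ((w \<circ> (*) p) (of_real t)) \<le> cmod (of_real t :: complex)"
    proof (rule Schwarz_Lemma(1))
      show "w \<circ> (*) p holomorphic_on ball 0 1"
        by (rule holomorphic_on_compose_gen[OF _ hol]) (auto intro!: holomorphic_intros in_D simp del: mem_ball)
      show "cmod ((w \<circ> (*) p) z) < 1" if "cmod z < 1" for z
        using that p less[of "p * z"] by (simp add: norm_mult)
    qed (use w0 t in auto)
    then show ?thesis using t by (simp add: mult.commute)
  qed
  have circle: "cmod (w z) \<le> 1" if "cmod z = cmod p" for z
  proof (rule continuous_on_closure_norm_le[of "ball 0 (cmod p)" w 1 z])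
    show "continuous_on (closure (ball 0 (cmod p))) w"
      using p by (intro continuous_on_subset[OF holomorphic_on_imp_continuous_on[OF hol]]) auto
  qed (use p that in \<open>auto intro!: less_imp_le[OF less]\<close>)
  define q where "q = cnj (w p) * (p * deriv w p)"
  have "1 \<le> Re q"
  proof (rule ccontr)
    assume "\<not> 1 \<le> Re q"
    let ?\<phi> = "\<lambda>t::real. (cmod (w (of_real t * p)))\<^sup>2 - t\<^sup>2"
    have "(?\<phi> has_real_derivative 2 * Re q - 2) (at 1)"
      using p DERIV_diff[OF DERIV_cmod_square_ray[OF hol, of 1 p] DERIV_power[OF DERIV_ident, of 2]]
      by (simp add: q_def)
    from DERIV_neg_dec_left[OF this] \<open>\<not> 1 \<le> Re q\<close>
    obtain d where d: "d > 0" "\<And>h. h > 0 \<Longrightarrow> h < d \<Longrightarrow> ?\<phi> 1 < ?\<phi> (1 - h)" by auto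
    define h where "h = min (d / 2) (1 / 2)"
    have h: "0 < h" "h < d" "0 \<le> 1 - h" "1 - h < 1" using d by (auto simp: h_def)
    have "?\<phi> (1 - h) \<le> 0" using ray[OF h(3,4)] h by (simp add: power_mono del: of_real_diff)
    with d(2)[OF h(1,2)] one show False by simp
  qed
  moreover have "Im q = 0"
  proof -
    let ?\<gamma> = "\<lambda>s::real. cis s * p"
    have "(?\<gamma> has_vector_derivative \<i> * p) (at 0)"
      unfolding cis_conv_exp
      by (auto intro!: derivative_eq_intros has_vector_derivative_real_field)
    moreover have "(w has_field_derivative deriv w p) (at (?\<gamma> 0))"
      using p by (auto intro!: holomorphic_derivI[OF hol])
    ultimately have "(w \<circ> ?\<gamma> has_vector_derivative \<i> * p * deriv w p) (at 0)"
      by (rule field_vector_diff_chain_at)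
    from DERIV_cmod_square[OF this]
    have "((\<lambda>s. (cmod ((w \<circ> ?\<gamma>) s))\<^sup>2) has_real_derivative - 2 * Im q) (at 0)"
      by (simp add: q_def algebra_simps)
    from DERIV_local_max[OF this zero_less_one] have "- 2 * Im q = 0"
      using one circle by (auto simp: norm_mult power_le_one)
    then show ?thesis by simp
  qed
  moreover have "p * deriv w p = q * w p"
  proof -
    have "w p * cnj (w p) = 1" using one complex_norm_square[of "w p"] by simp
    then show ?thesis by (simp add: q_def algebra_simps)
  qed
  moreover have "q = of_real (Re q)" using \<open>Im q = 0\<close> by (simp add: complex_eq_iff)
  ultimately show ?thesis by metis
qed

section \<open>The image of the disc under the map \<open>w/(1 + w)\<close>\<close>

text \<open>
  The map \<open>w/(1 + w)\<close> takes the unit circle to the line \<open>Re = 1/2\<close> and the disc to the half-plane on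
  its left. The first fact excludes \<open>|w| = 1\<close> for functions of the class, the second puts the
  extremal functions into it.
\<close>

lemma Re_div_one_plus:
  assumes "1 + w \<noteq> 0"
  shows "1 / 2 - Re (w / (1 + w)) = (1 - (cmod w)\<^sup>2) / (2 * (cmod (1 + w))\<^sup>2)"
proof -
  have "(cmod (1 + w))\<^sup>2 \<noteq> 0" using assms by simp
  moreover have "Re (w / (1 + w)) = (Re w + (cmod w)\<^sup>2) / (cmod (1 + w))\<^sup>2"
    by (simp add: Re_divide cmod_power2) (simp add: power2_eq_square algebra_simps)
  moreover have "(cmod (1 + w))\<^sup>2 = 1 + 2 * Re w + (cmod w)\<^sup>2"
    by (simp add: cmod_power2) (simp add: power2_eq_square algebra_simps)
  ultimately show ?thesis by (simp add: field_simps)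
qed

lemma one_plus_Re_pos:
  assumes "cmod w < 1"
  shows "0 < Re (1 + w)"
  using assms abs_Re_le_cmod[of w] by simp

lemma one_plus_neq_0:
  assumes "cmod w < 1"
  shows "1 + w \<noteq> 0"
  using one_plus_Re_pos[OF assms] by (metis less_irrefl zero_complex.simps(1))

section \<open>Representation by Schwarz functions\<close>

text \<open>
  The function \<open>w\<close> is defined from a logarithm \<open>H\<close> of \<open>f(z)/z\<close>, so at the outset nothing keeps
  \<open>1 + w\<close> in the domain where the principal \<open>Ln\<close> is continuous. Only after Jack's lemma has given
  \<open>|w| < 1\<close> can \<open>H/\<lambda>\<close> be identified with \<open>Ln (1 + w)\<close>.
\<close>

lemma class_N_representation:
  assumes lam: "0 < lam" and f: "f \<in> class_N lam"
  shows "\<exists>w. w holomorphic_on \<D> \<and> w 0 = 0 \<and> (\<forall>z\<in>\<D>. cmod (w z) \<le> cmod z) \<and>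
    (\<forall>z\<in>\<D>. quot_id f z = exp (of_real lam * Ln (1 + w z)))"
proof -
  have A: "f \<in> class_A" using f by (simp add: class_N_def)
  obtain G where G: "G holomorphic_on \<D>" "\<And>z. z \<in> \<D> \<Longrightarrow> exp (G z) = quot_id f z"
  proof (rule holomorphic_logarithm_exists[of \<D> "quot_id f" 0])
    show "quot_id f holomorphic_on \<D>" using quot_id_holomorphic[OF A] .
    show "quot_id f z \<noteq> 0" if "z \<in> \<D>" for z
      using class_N_nonzero[OF lam f that] by (simp add: quot_id_def)
  qed auto
  define H where "H z = G z - G 0" for z
  have H: "H holomorphic_on \<D>" "H 0 = 0" unfolding H_def by (auto intro!: holomorphic_intros G)
  have eH: "quot_id f z = exp (H z)" if "z \<in> \<D>" for z
    using G(2)[OF that] G(2)[of 0] by (simp add: H_def exp_diff quot_id_def)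
  define w where "w z = exp (H z / of_real lam) - 1" for z
  have w: "w holomorphic_on \<D>" "w 0 = 0"
    unfolding w_def using lam by (auto intro!: holomorphic_intros H simp: H(2))
  have w1: "1 + w z \<noteq> 0" for z by (simp add: w_def)
  have ode: "z * deriv f z / f z = 1 + of_real lam * (z * deriv w z / (1 + w z))"
    if z: "z \<in> \<D>" "z \<noteq> 0" for z
  proof -
    have dH: "(H has_field_derivative deriv H z) (at z)"
      using z by (intro holomorphic_derivI[OF H(1)]) auto
    have "(w has_field_derivative exp (H z / of_real lam) * (deriv H z / of_real lam)) (at z)"
      unfolding w_def using lam by (auto intro!: derivative_eq_intros dH)
    then have dw: "of_real lam * deriv w z = (1 + w z) * deriv H z"
      using lam by (simp add: DERIV_imp_deriv w_def)
    have "((\<lambda>z. z * exp (H z)) has_field_derivative exp (H z) + z * (exp (H z) * deriv H z)) (at z)"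
      by (auto intro!: derivative_eq_intros dH)
    moreover have feq: "f u = u * exp (H u)" if "u \<in> \<D>" for u
      using eH[OF that] class_A_D(2)[OF A] by (auto simp: quot_id_def field_simps split: if_splits)
    ultimately have "(f has_field_derivative exp (H z) + z * (exp (H z) * deriv H z)) (at z)"
      using z(1) has_field_derivative_transform_within_open[of _ _ z \<D> f] by fastforce
    then have "z * deriv f z / f z = 1 + z * deriv H z"
      using z feq[of z] by (simp add: DERIV_imp_deriv field_simps)
    also have "deriv H z = of_real lam * deriv w z / (1 + w z)"
      using dw w1[of z] by (simp add: field_simps)
    finally show ?thesis by simp
  qed
  have lt1: "cmod (w z) < 1" if z: "z \<in> \<D>" for z
  proof (rule ccontr)
    assume "\<not> cmod (w z) < 1"
    \<comment> \<open>Jack's lemma applies at a point of least modulus among those with \<open>|w| \<ge> 1\<close>.\<close>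
    define S where "S = {u \<in> cball 0 (cmod z). 1 \<le> cmod (w u)}"
    have cont: "continuous_on (cball 0 (cmod z)) w"
      using z by (intro continuous_on_subset[OF holomorphic_on_imp_continuous_on[OF w(1)]]) auto
    have "closed S" unfolding S_def
      by (intro continuous_on_closed_Collect_le continuous_intros cont) auto
    moreover have "z \<in> S" using \<open>\<not> cmod (w z) < 1\<close> by (simp add: S_def)
    ultimately obtain p where p: "p \<in> S" "\<And>y. y \<in> S \<Longrightarrow> dist 0 p \<le> dist 0 y"
      using distance_attains_inf[of S 0] by blast
    have pz: "cmod p \<le> cmod z" using p(1) by (simp add: S_def)
    then have pD: "p \<in> \<D>" using z by simp
    have p0: "p \<noteq> 0" using p(1) w(2) by (auto simp: S_def)
    have less: "cmod (w u) < 1" if "cmod u < cmod p" for u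
      using p(2)[of u] that pz by (force simp: S_def)
    have "cmod (w p) \<le> 1"
    proof (rule continuous_on_closure_norm_le[of "ball 0 (cmod p)" w 1 p])
      show "continuous_on (closure (ball 0 (cmod p))) w"
        using p0 pz by (intro continuous_on_subset[OF cont]) auto
    qed (use p0 in \<open>auto intro!: less_imp_le[OF less]\<close>)
    then have one: "cmod (w p) = 1" using p(1) by (simp add: S_def)
    obtain k :: real where k: "1 \<le> k" "p * deriv w p = of_real k * w p"
      using Jack[OF w pD p0 less one] by blast
    have "Re (w p / (1 + w p)) = 1 / 2"
      using Re_div_one_plus[OF w1, of p] one by simp
    moreover have "p * deriv f p / f p = 1 + of_real (lam * k) * (w p / (1 + w p))"
      using ode[OF pD p0] k(2) by simp
    ultimately have "Re (p * deriv f p / f p) = 1 + lam * k / 2"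
      by (simp del: of_real_mult times_divide_eq_right)
    moreover have "lam * 1 \<le> lam * k" using k lam by (intro mult_left_mono) auto
    moreover have "Re (p * deriv f p / f p) < 1 + lam / 2"
      using f pD by (simp add: class_N_def)
    ultimately show False by simp
  qed
  have le: "cmod (w z) \<le> cmod z" if "z \<in> \<D>" for z
    using Schwarz_Lemma(1)[OF w, of z] lt1 that by simp
  \<comment> \<open>Both sides of the next equation are logarithms of \<open>1 + w\<close>. Their difference is a continuous
      function with values in \<open>2 \<pi> \<i> \<int>\<close> on the connected disc, and it vanishes at \<open>0\<close>.\<close>
  have log: "H z / of_real lam = Ln (1 + w z)" if "z \<in> \<D>" for z
  proof -
    let ?d = "\<lambda>z. H z / of_real lam - Ln (1 + w z)"
    have e: "exp (?d u) = 1" for u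
      using w1[of u] by (simp add: exp_diff) (simp add: w_def)
    have "?d constant_on \<D>"
    proof (rule continuous_discrete_range_constant)
      show "continuous_on \<D> ?d"
        using lam one_plus_Re_pos[OF lt1]
        by (intro continuous_intros holomorphic_on_imp_continuous_on H w)
           (auto simp: complex_nonpos_Reals_iff not_le)
      fix x assume "x \<in> \<D>"
      have "2 * pi \<le> cmod (?d y - ?d x)" if "?d y \<noteq> ?d x" for y
      proof (rule ccontr)
        assume "\<not> 2 * pi \<le> cmod (?d y - ?d x)"
        then have "\<bar>Im (?d y) - Im (?d x)\<bar> < 2 * pi"
          using abs_Im_le_cmod[of "?d y - ?d x"] by simp
        moreover have "exp (?d y) = exp (?d x)" by (simp only: e)
        ultimately have "?d y = ?d x" by (rule exp_complex_eqI)
        with that show False by contradiction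
      qed
      then show "\<exists>\<epsilon>>0. \<forall>y. y \<in> \<D> \<and> ?d y \<noteq> ?d x \<longrightarrow> \<epsilon> \<le> cmod (?d y - ?d x)"
        by (intro exI[of _ "2 * pi"]) auto
    qed simp
    then obtain c where c: "\<And>u. u \<in> \<D> \<Longrightarrow> ?d u = c" by (auto simp: constant_on_def)
    have "?d z = ?d 0" using c[OF that] c[of 0] by simp
    then show ?thesis using H w by simp
  qed
  have "quot_id f z = exp (of_real lam * Ln (1 + w z))" if "z \<in> \<D>" for z
    using eH[OF that] log[OF that, symmetric] lam by simp
  then show ?thesis using w le by blast
qed

section \<open>Modulus and argument of powers of \<open>1 + w\<close>\<close>

lemma cmod_exp_Ln:
  assumes "u \<noteq> 0"
  shows "cmod (exp (of_real lam * Ln u)) = cmod u powr lam"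
  using assms by (simp add: norm_exp_eq_Re powr_def)

lemma cmod_one_plus_powr_bounds:
  fixes w :: complex
  assumes "cmod w \<le> r" "r < 1" "0 \<le> lam"
  shows "(1 - r) powr lam \<le> cmod (1 + w) powr lam" "cmod (1 + w) powr lam \<le> (1 + r) powr lam"
proof -
  have "1 - r \<le> cmod (1 + w)" "cmod (1 + w) \<le> 1 + r"
    using assms norm_triangle_ineq[of 1 w] norm_diff_ineq[of 1 w] by auto
  then show "(1 - r) powr lam \<le> cmod (1 + w) powr lam" "cmod (1 + w) powr lam \<le> (1 + r) powr lam"
    using assms by (auto intro!: powr_mono2)
qed

text \<open>
  Twice the area of the triangle \<open>0, 1, 1 + w\<close> gives \<open>sin |Arg (1 + w)| = |Im w| / |1 + w|\<close>, and with
  \<open>x = Re w\<close> the claim \<open>(Im w)\<^sup>2 \<le> r\<^sup>2 |1 + w|\<^sup>2\<close> reduces to \<open>0 \<le> (r\<^sup>2 + x)\<^sup>2\<close>. The case of equality,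
  \<open>x = - r\<^sup>2\<close> and \<open>|w| = r\<close>, is the point of tangency.
\<close>

lemma abs_Im_Ln_one_plus_le:
  assumes "cmod w \<le> r" "r < 1"
  shows "\<bar>Im (Ln (1 + w))\<bar> \<le> arcsin r"
proof -
  define a where "a = \<bar>Im (Ln (1 + w))\<bar>"
  have r0: "0 \<le> r" using assms(1) norm_ge_zero order_trans by blast
  have w: "cmod w < 1" using assms by simp
  note nz = one_plus_neq_0[OF w]
  have a: "0 \<le> a" "a < pi / 2"
    using Re_Ln_pos_lt[OF nz] one_plus_Re_pos[OF w] by (auto simp: a_def)
  have h: "Im (1 + w) = cmod (1 + w) * sin (Im (Ln (1 + w)))"
    using nz by (metis Im_exp exp_Ln norm_exp_eq_Re)
  have eq: "(cmod (1 + w) * sin a)\<^sup>2 = (Im w)\<^sup>2"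
  proof -
    have "(sin a)\<^sup>2 = (sin (Im (Ln (1 + w))))\<^sup>2" unfolding a_def abs_if by simp
    then have "(cmod (1 + w) * sin a)\<^sup>2 = (Im (1 + w))\<^sup>2"
      unfolding h power_mult_distrib by (rule arg_cong)
    then show ?thesis by simp
  qed
  have "(cmod w)\<^sup>2 \<le> r\<^sup>2" using assms by (intro power_mono) auto
  then have y: "(Im w)\<^sup>2 \<le> r\<^sup>2 - (Re w)\<^sup>2" by (simp add: cmod_power2)
  have "r\<^sup>2 \<le> 1" using r0 assms(2) by (simp add: power_le_one)
  then have "(Im w)\<^sup>2 * (1 - r\<^sup>2) \<le> (r\<^sup>2 - (Re w)\<^sup>2) * (1 - r\<^sup>2)"
    using y by (intro mult_right_mono) auto
  also have "\<dots> = r\<^sup>2 * (1 + Re w)\<^sup>2 - (r\<^sup>2 + Re w)\<^sup>2"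
    by (simp add: power2_eq_square algebra_simps)
  finally have le: "(Im w)\<^sup>2 * (1 - r\<^sup>2) \<le> r\<^sup>2 * (1 + Re w)\<^sup>2 - (r\<^sup>2 + Re w)\<^sup>2" .
  have "(Im w)\<^sup>2 = (Im w)\<^sup>2 * (1 - r\<^sup>2) + r\<^sup>2 * (Im w)\<^sup>2" by (simp add: algebra_simps)
  also have "\<dots> \<le> r\<^sup>2 * (1 + Re w)\<^sup>2 + r\<^sup>2 * (Im w)\<^sup>2"
    using le zero_le_power2[of "r\<^sup>2 + Re w"] by linarith
  finally have "(Im w)\<^sup>2 \<le> r\<^sup>2 * ((1 + Re w)\<^sup>2 + (Im w)\<^sup>2)" by (simp add: distrib_left)
  then have "(cmod (1 + w) * sin a)\<^sup>2 \<le> (cmod (1 + w) * r)\<^sup>2"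
    unfolding eq by (simp add: power_mult_distrib cmod_power2 mult.commute)
  then have "cmod (1 + w) * sin a \<le> cmod (1 + w) * r"
    by (rule power2_le_imp_le) (use r0 in simp)
  then have "sin a \<le> r" using nz by simp
  moreover have "-1 \<le> sin a" by simp
  ultimately have "arcsin (sin a) \<le> arcsin r" using assms by (intro arcsin_le_arcsin) auto
  then show ?thesis using a arcsin_sin[of a] by (simp add: a_def)
qed

lemma Ln_one_plus_tangent_point:
  assumes "0 \<le> r" "r < 1"
  obtains w where "cmod w = r" "Im (Ln (1 + w)) = arcsin r"
proof
  define s where "s = sqrt (1 - r\<^sup>2)"
  have "r\<^sup>2 < 1" using assms by (simp add: power_less_one_iff abs_square_less_1)
  then have s: "0 < s" "s\<^sup>2 = 1 - r\<^sup>2" by (auto simp: s_def)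
  \<comment> \<open>The tangent from \<open>0\<close> to the circle \<open>|u - 1| = r\<close> has length \<open>s\<close>, by Pythagoras.\<close>
  define w where "w = Complex (- (r\<^sup>2)) (r * s)"
  have "(cmod w)\<^sup>2 = r\<^sup>2 * (r\<^sup>2 + s\<^sup>2)"
    unfolding cmod_power2 by (simp add: w_def power2_eq_square algebra_simps)
  then have "(cmod w)\<^sup>2 = r\<^sup>2" using s by simp
  then show "cmod w = r" using assms by simp
  have "1 + w = of_real s * cis (arcsin r)"
    using assms s cos_arcsin[of r]
    by (simp add: complex_eq_iff w_def s_def[symmetric]) (simp add: power2_eq_square)
  also have "\<dots> = exp (Complex (ln s) (arcsin r))"
    using s by (simp add: exp_eq_polar exp_of_real)
  finally have "1 + w = exp (Complex (ln s) (arcsin r))" .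
  moreover have "- pi < arcsin r" "arcsin r \<le> pi"
    using arcsin_lt_bounded[of r] assms pi_gt_zero by linarith+
  ultimately have "Ln (1 + w) = Complex (ln s) (arcsin r)" by (metis Ln_exp complex.sel(2))
  then show "Im (Ln (1 + w)) = arcsin r" by simp
qed

section \<open>Continuous branches of the argument\<close>

text \<open>
  Two branches differ by a continuous function with values in \<open>2 \<pi> \<int>\<close>, so a continuous logarithm
  determines every branch.
\<close>

lemma arg_branch_exp:
  assumes "continuous_on \<D> H" "H 0 = 0" "\<And>z. z \<in> \<D> \<Longrightarrow> q z = exp (H z)"
  shows "arg_branch q (\<lambda>z. Im (H z))"
    and "arg_branch q \<theta> \<Longrightarrow> z \<in> \<D> \<Longrightarrow> \<theta> z = Im (H z)"
proof -
  show "arg_branch q (\<lambda>z. Im (H z))"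
    unfolding arg_branch_def using assms by (auto intro!: continuous_intros is_Arg_exp_Im)
  assume \<theta>: "arg_branch q \<theta>" and z: "z \<in> \<D>"
  let ?d = "\<lambda>z. Im (H z) - \<theta> z"
  have int: "\<exists>k::int. ?d u = of_int k * (2 * pi)" if u: "u \<in> \<D>" for u
  proof -
    have "is_Arg (exp (H u)) (\<theta> u)"
      using \<theta> u assms(3) by (auto simp: arg_branch_def)
    from is_Arg_exp_diff_2pi[OF this] obtain k :: int where "Im (H u) - of_int k * (2 * pi) = \<theta> u"
      by blast
    then show ?thesis by (intro exI[of _ k]) simp
  qed
  have "?d constant_on \<D>"
  proof (rule continuous_discrete_range_constant)
    show "continuous_on \<D> ?d"
      using \<theta> assms(1) by (auto simp: arg_branch_def intro!: continuous_intros)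
    fix x assume x: "x \<in> \<D>"
    have "2 * pi \<le> norm (?d y - ?d x)" if y: "y \<in> \<D>" "?d y \<noteq> ?d x" for y
    proof -
      obtain k l :: int where kl: "?d y = of_int k * (2 * pi)" "?d x = of_int l * (2 * pi)"
        using int[OF y(1)] int[OF x] by blast
      then have "k \<noteq> l" using y(2) by auto
      then have "1 * (2 * pi) \<le> \<bar>of_int (k - l)\<bar> * (2 * pi)"
        by (intro mult_right_mono) (auto simp del: of_int_diff)
      also have "\<dots> = norm (?d y - ?d x)" by (simp add: kl abs_mult left_diff_distrib[symmetric])
      finally show ?thesis by simp
    qed
    then show "\<exists>\<epsilon>>0. \<forall>y. y \<in> \<D> \<and> ?d y \<noteq> ?d x \<longrightarrow> \<epsilon> \<le> norm (?d y - ?d x)"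
      by (intro exI[of _ "2 * pi"]) auto
  qed simp
  then obtain c where c: "\<And>u. u \<in> \<D> \<Longrightarrow> ?d u = c" by (auto simp: constant_on_def)
  have "?d z = ?d 0" using c[OF z] c[of 0] by simp
  then show "\<theta> z = Im (H z)" using \<theta> assms(2) by (simp add: arg_branch_def)
qed

lemma arg_branch_one_plus_powr:
  assumes w: "continuous_on \<D> w" "w 0 = 0" "\<forall>z\<in>\<D>. cmod (w z) < 1"
    and q: "\<forall>z\<in>\<D>. q z = exp (of_real lam * Ln (1 + w z))"
  shows "\<exists>\<theta>. arg_branch q \<theta>"
    and "arg_branch q \<theta> \<Longrightarrow> z \<in> \<D> \<Longrightarrow> \<theta> z = lam * Im (Ln (1 + w z))"
proof -
  have cont: "continuous_on \<D> (\<lambda>z. of_real lam * Ln (1 + w z))"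
    using one_plus_Re_pos[OF bspec[OF w(3)]]
    by (intro continuous_intros w) (auto simp: complex_nonpos_Reals_iff not_le)
  have zero: "of_real lam * Ln (1 + w 0) = 0" using w(2) by simp
  show "\<exists>\<theta>. arg_branch q \<theta>"
    using arg_branch_exp(1)[OF cont zero bspec[OF q]] by blast
  show "\<theta> z = lam * Im (Ln (1 + w z))" if "arg_branch q \<theta>" "z \<in> \<D>"
    using arg_branch_exp(2)[OF cont zero bspec[OF q] that] by simp
qed

section \<open>The rotations of the extremal function\<close>

lemma rotation_N_F:
  assumes "cmod \<mu> = 1" "cmod z < 1"
  shows "rotation \<mu> (N_F lam) z = z * exp (of_real lam * Ln (1 + \<mu> * z))"
proof -
  have "1 + \<mu> * z \<noteq> 0" using assms by (intro one_plus_neq_0) (simp add: norm_mult)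
  moreover have "cnj \<mu> * \<mu> = 1"
    using complex_norm_square[of \<mu>] assms by (simp add: mult.commute)
  ultimately show ?thesis
    by (simp add: rotation_def N_F_def powr_def mult.assoc[symmetric])
qed

text \<open>Here \<open>z g'/g = 1 + \<lambda> v/(1 + v)\<close> with \<open>v = \<mu>z\<close>, and \<open>v/(1 + v)\<close> stays in the
  half-plane \<open>Re < 1/2\<close>.\<close>

lemma rotation_N_F_class_N:
  assumes lam: "0 < lam" and mu: "cmod \<mu> = 1"
  shows "rotation \<mu> (N_F lam) \<in> class_N lam"
proof -
  let ?g = "rotation \<mu> (N_F lam)"
  have nrm: "cmod (\<mu> * z) < 1" if "z \<in> \<D>" for z using that mu by (simp add: norm_mult)
  have der: "(?g has_field_derivative
      exp (of_real lam * Ln (1 + \<mu> * z)) * (1 + of_real lam * (\<mu> * z / (1 + \<mu> * z)))) (at z)"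
    if z: "z \<in> \<D>" for z
  proof (rule has_field_derivative_transform_within_open[of _ _ z \<D>])
    have "1 + \<mu> * z \<notin> \<real>\<^sub>\<le>\<^sub>0"
      using one_plus_Re_pos[OF nrm[OF z]] by (auto simp: complex_nonpos_Reals_iff)
    then show "((\<lambda>z. z * exp (of_real lam * Ln (1 + \<mu> * z))) has_field_derivative
      exp (of_real lam * Ln (1 + \<mu> * z)) * (1 + of_real lam * (\<mu> * z / (1 + \<mu> * z)))) (at z)"
      by (auto intro!: derivative_eq_intros simp: algebra_simps divide_inverse)
  qed (use z mu in \<open>auto simp: rotation_N_F\<close>)
  have "?g \<in> class_A"
  proof (rule class_A_I)
    show "?g holomorphic_on \<D>" using der by (metis holomorphic_on_open open_ball)
    show "?g 0 = 0" using mu by (simp add: rotation_N_F)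
    show "deriv ?g 0 = 1" using DERIV_imp_deriv[OF der[of 0]] by simp
  qed
  moreover have "Re (z * deriv ?g z / ?g z) < 1 + lam / 2" if z: "z \<in> \<D>" for z
  proof (cases "z = 0")
    case True
    then show ?thesis using lam by simp
  next
    case False
    define v where "v = \<mu> * z"
    have v: "cmod v < 1" using nrm[OF z] by (simp add: v_def)
    note nz = one_plus_neq_0[OF v]
    have "z * deriv ?g z / ?g z = 1 + of_real lam * (v / (1 + v))"
      using False z mu by (simp add: DERIV_imp_deriv[OF der[OF z]] rotation_N_F v_def)
    moreover have "0 < (1 - (cmod v)\<^sup>2) / (2 * (cmod (1 + v))\<^sup>2)"
      using v nz by (intro divide_pos_pos) (auto simp: power_less_one_iff abs_square_less_1)
    then have "Re (v / (1 + v)) < 1 / 2" using Re_div_one_plus[OF nz] by simp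
    then have "lam * Re (v / (1 + v)) < lam * (1 / 2)" using lam by (intro mult_strict_left_mono)
    ultimately show ?thesis by (simp del: times_divide_eq_right)
  qed
  ultimately show ?thesis by (simp add: class_N_def)
qed

section \<open>Growth and argument bounds\<close>

theorem theorem3p12:
  fixes lam :: real and f :: "complex \<Rightarrow> complex"
  assumes "0 < lam" and "lam \<le> 1" and "f \<in> class_N lam"
  shows "(\<forall>z r. cmod z = r \<and> r < 1 \<longrightarrow>
            - N_F lam (- complex_of_real r) = complex_of_real (r * (1 - r) powr lam) \<and>
            r * (1 - r) powr lam \<le> cmod (f z) \<and>
            cmod (f z) \<le> r * (1 + r) powr lam \<and>
            complex_of_real (r * (1 + r) powr lam) = N_F lam (complex_of_real r)) \<and>
         (\<exists>\<theta>. arg_branch (quot_id f) \<theta>) \<and>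
         (\<forall>\<theta>. arg_branch (quot_id f) \<theta> \<longrightarrow>
            (\<forall>z r. cmod z = r \<and> r < 1 \<longrightarrow> \<bar>\<theta> z\<bar> \<le> lam * arcsin r)) \<and>
         (\<forall>\<mu> g. cmod \<mu> = 1 \<and> g = rotation \<mu> (N_F lam) \<longrightarrow>
            g \<in> class_N lam \<and>
            (\<exists>\<theta>. arg_branch (quot_id g) \<theta>) \<and>
            (\<forall>r. 0 \<le> r \<and> r < 1 \<longrightarrow>
               (\<exists>z. cmod z = r \<and> cmod (g z) = r * (1 - r) powr lam) \<and>
               (\<exists>z. cmod z = r \<and> cmod (g z) = r * (1 + r) powr lam) \<and>
               (\<forall>\<theta>. arg_branch (quot_id g) \<theta> \<longrightarrow>
                  (\<exists>z. cmod z = r \<and> \<bar>\<theta> z\<bar> = lam * arcsin r))))"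
proof -
  obtain w where w: "w holomorphic_on \<D>" "w 0 = 0" "\<And>z. z \<in> \<D> \<Longrightarrow> cmod (w z) \<le> cmod z"
    and q: "\<And>z. z \<in> \<D> \<Longrightarrow> quot_id f z = exp (of_real lam * Ln (1 + w z))"
    using class_N_representation[OF assms(1,3)] by metis
  have lt1: "cmod (w z) < 1" if "z \<in> \<D>" for z using w(3)[OF that] that by simp
  have growth: "- N_F lam (- complex_of_real r) = complex_of_real (r * (1 - r) powr lam) \<and>
      r * (1 - r) powr lam \<le> cmod (f z) \<and> cmod (f z) \<le> r * (1 + r) powr lam \<and>
      complex_of_real (r * (1 + r) powr lam) = N_F lam (complex_of_real r)"
    if r: "cmod z = r" "r < 1" for z r
  proof -
    have r0: "0 \<le> r" and z: "z \<in> \<D>" using r by auto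
    have "f z = z * quot_id f z"
      using assms(3) class_A_D(2)[of f] by (simp add: quot_id_def class_N_def)
    then have "cmod (f z) = r * cmod (1 + w z) powr lam"
      using r q[OF z] one_plus_neq_0[OF lt1[OF z]] by (simp add: norm_mult cmod_exp_Ln del: norm_exp_eq_Re)
    moreover have "(1 - r) powr lam \<le> cmod (1 + w z) powr lam"
      "cmod (1 + w z) powr lam \<le> (1 + r) powr lam"
      using cmod_one_plus_powr_bounds[of "w z" r lam] r w(3)[OF z] assms(1) by auto
    moreover have "- N_F lam (- complex_of_real r) = complex_of_real (r * (1 - r) powr lam)"
      "complex_of_real (r * (1 + r) powr lam) = N_F lam (complex_of_real r)"
      using powr_of_real[of "1 - r" lam] powr_of_real[of "1 + r" lam] r r0 by (auto simp: N_F_def)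
    ultimately show ?thesis using r0 by (simp add: mult_left_mono)
  qed
  have "\<forall>z\<in>\<D>. cmod (w z) < 1" "\<forall>z\<in>\<D>. quot_id f z = exp (of_real lam * Ln (1 + w z))"
    using lt1 q by blast+
  note branch = arg_branch_one_plus_powr[OF holomorphic_on_imp_continuous_on[OF w(1)] w(2) this]
  have arg: "\<bar>\<theta> z\<bar> \<le> lam * arcsin r" if "arg_branch (quot_id f) \<theta>" "cmod z = r" "r < 1" for \<theta> z r
  proof -
    have "\<theta> z = lam * Im (Ln (1 + w z))" using branch(2) that by simp
    moreover have "\<bar>Im (Ln (1 + w z))\<bar> \<le> arcsin r"
      using w(3)[of z] that by (intro abs_Im_Ln_one_plus_le) auto
    ultimately show ?thesis using assms(1) by (simp add: abs_mult)
  qed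
  have sharp: "g \<in> class_N lam \<and> (\<exists>\<theta>. arg_branch (quot_id g) \<theta>) \<and>
            (\<forall>r. 0 \<le> r \<and> r < 1 \<longrightarrow>
               (\<exists>z. cmod z = r \<and> cmod (g z) = r * (1 - r) powr lam) \<and>
               (\<exists>z. cmod z = r \<and> cmod (g z) = r * (1 + r) powr lam) \<and>
               (\<forall>\<theta>. arg_branch (quot_id g) \<theta> \<longrightarrow>
                  (\<exists>z. cmod z = r \<and> \<bar>\<theta> z\<bar> = lam * arcsin r)))"
    if mu: "cmod \<mu> = 1" and g: "g = rotation \<mu> (N_F lam)" for \<mu> g
  proof -
    have gz: "g z = z * exp (of_real lam * Ln (1 + \<mu> * z))" if "z \<in> \<D>" for z
      using rotation_N_F[OF mu, of z lam] that g by simp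
    then have qg: "\<forall>z\<in>\<D>. quot_id g z = exp (of_real lam * Ln (1 + \<mu> * z))"
      by (simp add: quot_id_def)
    have cont: "continuous_on \<D> (\<lambda>z. \<mu> * z)" by (intro continuous_intros)
    have small: "\<forall>z\<in>\<D>. cmod (\<mu> * z) < 1"
      using mu by (simp add: norm_mult)
    note br = arg_branch_one_plus_powr[OF cont mult_zero_right small qg]
    have mc: "\<mu> * (cnj \<mu> * v) = v" for v
      using complex_norm_square[of \<mu>] mu by (simp add: mult.assoc[symmetric])
    \<comment> \<open>The substitution \<open>z = cnj \<mu> * v\<close> undoes the rotation, so the extremal points are read off
        from \<open>1 + v\<close> with \<open>|v| = r\<close>.\<close>
    have mod: "cmod (cnj \<mu> * v) = cmod v \<and> cmod (g (cnj \<mu> * v)) = cmod v * cmod (1 + v) powr lam"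
      if "cmod v < 1" for v
      using that mu gz[of "cnj \<mu> * v"] one_plus_neq_0[OF that]
      by (simp add: norm_mult mc cmod_exp_Ln del: norm_exp_eq_Re)
    have bounds: "(\<exists>z. cmod z = r \<and> cmod (g z) = r * (1 - r) powr lam) \<and>
          (\<exists>z. cmod z = r \<and> cmod (g z) = r * (1 + r) powr lam) \<and>
          (\<forall>\<theta>. arg_branch (quot_id g) \<theta> \<longrightarrow> (\<exists>z. cmod z = r \<and> \<bar>\<theta> z\<bar> = lam * arcsin r))"
      if r: "0 \<le> r" "r < 1" for r
    proof (intro conjI allI impI)
      have "cmod (1 - complex_of_real r) = 1 - r" "cmod (1 + complex_of_real r) = 1 + r"
        using r norm_of_real[of "1 - r", where 'a = complex] norm_of_real[of "1 + r", where 'a = complex]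
        by auto
      note real = this
      show "\<exists>z. cmod z = r \<and> cmod (g z) = r * (1 - r) powr lam"
        using mod[of "- of_real r"] real r by (intro exI[of _ "cnj \<mu> * - of_real r"]) simp
      show "\<exists>z. cmod z = r \<and> cmod (g z) = r * (1 + r) powr lam"
        using mod[of "of_real r"] real r by (intro exI[of _ "cnj \<mu> * of_real r"]) simp
    next
      fix \<theta> assume \<theta>: "arg_branch (quot_id g) \<theta>"
      obtain v where v: "cmod v = r" "Im (Ln (1 + v)) = arcsin r"
        using Ln_one_plus_tangent_point[OF r] .
      have "\<theta> (cnj \<mu> * v) = lam * Im (Ln (1 + \<mu> * (cnj \<mu> * v)))"
        using br(2)[OF \<theta>] mu v r by (simp add: norm_mult)
      then have "\<theta> (cnj \<mu> * v) = lam * arcsin r" by (simp add: mc v)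
      moreover have "0 \<le> lam * arcsin r" using assms(1) arcsin_nonneg[of r] r by simp
      ultimately show "\<exists>z. cmod z = r \<and> \<bar>\<theta> z\<bar> = lam * arcsin r"
        using mod[of v] v r by (intro exI[of _ "cnj \<mu> * v"]) simp
    qed
    have "g \<in> class_N lam" using rotation_N_F_class_N[OF assms(1) mu] g by simp
    then show ?thesis
      by (rule conjI[OF _ conjI[OF br(1)]]) (intro allI impI, elim conjE, rule bounds)
  qed
  show ?thesis
  proof (intro conjI[OF _ conjI[OF branch(1) conjI]] allI impI)
    fix z r assume r: "cmod z = r \<and> r < 1"
    then show "- N_F lam (- complex_of_real r) = complex_of_real (r * (1 - r) powr lam) \<and>
        r * (1 - r) powr lam \<le> cmod (f z) \<and> cmod (f z) \<le> r * (1 + r) powr lam \<and>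
        complex_of_real (r * (1 + r) powr lam) = N_F lam (complex_of_real r)"
      using growth[of z r] by simp
  next
    fix \<theta> z r assume "arg_branch (quot_id f) \<theta>" "cmod z = r \<and> r < 1"
    then show "\<bar>\<theta> z\<bar> \<le> lam * arcsin r" using arg by blast
  next
    fix \<mu> g assume "cmod \<mu> = 1 \<and> g = rotation \<mu> (N_F lam)"
    then show "g \<in> class_N lam \<and> (\<exists>\<theta>. arg_branch (quot_id g) \<theta>) \<and>
            (\<forall>r. 0 \<le> r \<and> r < 1 \<longrightarrow>
               (\<exists>z. cmod z = r \<and> cmod (g z) = r * (1 - r) powr lam) \<and>
               (\<exists>z. cmod z = r \<and> cmod (g z) = r * (1 + r) powr lam) \<and>
               (\<forall>\<theta>. arg_branch (quot_id g) \<theta> \<longrightarrow>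
                  (\<exists>z. cmod z = r \<and> \<bar>\<theta> z\<bar> = lam * arcsin r)))"
      by (elim conjE) (rule sharp)
  qed
qed

end
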